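(* Let $n\ge 2$. Then $\Theta_1(\Gamma_n)\cup\Theta_n(\Gamma_n)$ is a maximal (with respect to inclusion) edge general position set of $\Gamma_n$. Moreover, ${\rm gp_e}(\Gamma_n)\ge 2F_n$.
   Context: Fibonacci numbers: $F_0=0$, $F_1=1$, $F_{m+2}=F_{m+1}+F_m$. The Fibonacci cube $\Gamma_n$ is the graph whose vertices are the binary strings of length $n$ with no two consecutive 1s, two vertices being adjacent iff they differ in exactly one coordinate. For $i\in\{1,\ldots,n\}$, $\Theta_i(\Gamma_n)$ is the set of edges of $\Gamma_n$ whose endpoints differ in coordinate $i$. A set of edges $X\subseteq E(G)$ is an edge general position set of a graph $G$ if no three edges of $X$ lie on a common shortest path of $G$; ${\rm gp_e}(G)$ is the maximum cardinality of an edge general position set of $G$. *)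

theory Defs
  imports Main "HOL-Number_Theory.Fib"
begin

text \<open>A graph is given by its vertex set and its edge set, an undirected edge being the
  two-element set of its endpoints.\<close>

record 'a ugraph =
  verts :: "'a set"
  edges :: "'a set set"

text \<open>A path is represented by its nonempty list of vertices, so its length is one less than
  the length of the list.\<close>

definition is_path :: "'a ugraph \<Rightarrow> 'a list \<Rightarrow> bool" where
  "is_path G p \<longleftrightarrow> p \<noteq> [] \<and> distinct p \<and> set p \<subseteq> verts G \<and>
     (\<forall>j. Suc j < length p \<longrightarrow> {p ! j, p ! Suc j} \<in> edges G)"

definition is_shortest_path :: "'a ugraph \<Rightarrow> 'a list \<Rightarrow> bool" where
  "is_shortest_path G p \<longleftrightarrow> is_path G p \<and>
     (\<forall>q. is_path G q \<and> hd q = hd p \<and> last q = last p \<longrightarrow> length p \<le> length q)"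

definition path_edges :: "'a list \<Rightarrow> 'a set set" where
  "path_edges p = {{p ! j, p ! Suc j} | j. Suc j < length p}"

definition edge_gp_set :: "'a ugraph \<Rightarrow> 'a set set \<Rightarrow> bool" where
  "edge_gp_set G X \<longleftrightarrow> X \<subseteq> edges G \<and>
     \<not> (\<exists>p e f g. is_shortest_path G p \<and> e \<in> X \<and> f \<in> X \<and> g \<in> X \<and>
          e \<noteq> f \<and> e \<noteq> g \<and> f \<noteq> g \<and> {e, f, g} \<subseteq> path_edges p)"

definition maximal_edge_gp_set :: "'a ugraph \<Rightarrow> 'a set set \<Rightarrow> bool" where
  "maximal_edge_gp_set G X \<longleftrightarrow> edge_gp_set G X \<and>
     (\<forall>Y. edge_gp_set G Y \<and> X \<subseteq> Y \<longrightarrow> Y = X)"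

text \<open>Meaningful for graphs with finitely many edges.\<close>

definition gp_e :: "'a ugraph \<Rightarrow> nat" where
  "gp_e G = Max (card ` {X. edge_gp_set G X})"

definition fib_strings :: "nat \<Rightarrow> bool list set" where
  "fib_strings n = {s. length s = n \<and> (\<forall>j. Suc j < n \<longrightarrow> \<not> (s ! j \<and> s ! Suc j))}"

definition fib_cube :: "nat \<Rightarrow> bool list ugraph" where
  "fib_cube n =
     \<lparr>verts = fib_strings n,
      edges = {{u, v} | u v. u \<in> fib_strings n \<and> v \<in> fib_strings n \<and>
                             (\<exists>!j. j < n \<and> u ! j \<noteq> v ! j)}\<rparr>"

text \<open>Coordinates are numbered from 1, list positions from 0.\<close>

definition Theta :: "nat \<Rightarrow> bool list ugraph \<Rightarrow> bool list set set" where
  "Theta i G = {e \<in> edges G. \<exists>u v. e = {u, v} \<and> u ! (i - 1) \<noteq> v ! (i - 1)}"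

lemma finite_edges_fib_cube: "finite (edges (fib_cube n))"
proof -
  have "fib_strings n \<subseteq> {s. set s \<subseteq> UNIV \<and> length s = n}"
    by (auto simp: fib_strings_def)
  then have "finite (fib_strings n)"
    using finite_lists_length_eq[of "UNIV :: bool set" n] finite_subset by auto
  moreover have "edges (fib_cube n) \<subseteq> Pow (fib_strings n)"
    by (auto simp: fib_cube_def)
  ultimately show ?thesis
    by (meson finite_Pow_iff finite_subset)
qed

lemma finite_edge_gp_sets: "finite (edges G) \<Longrightarrow> finite {X. edge_gp_set G X}"
  by (rule finite_subset[of _ "Pow (edges G)"]) (auto simp: edge_gp_set_def)

lemma edge_gp_set_empty: "edge_gp_set G {}"
  by (simp add: edge_gp_set_def)

end

theory Submission
  imports Defs
begin

text \<open>Flipping first the 1s and then the 0s in which two Fibonacci strings differ never leaves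
  the Fibonacci strings, so distances in the Fibonacci cube are Hamming distances and a shortest
  path flips every coordinate at most once.  It therefore contains at most one edge of each
  \<open>\<Theta>\<close>-class, hence at most two edges of \<open>\<Theta>\<^sub>1 \<union> \<Theta>\<^sub>n\<close>.
  For maximality let \<open>uv\<close> be an edge in direction \<open>i\<close> with \<open>1 < i < n\<close> and \<open>u\<^sub>i = 0\<close>.
  From \<open>v\<close> move to \<open>u\<close>, clear coordinate \<open>2\<close> if necessary, flip coordinate \<open>1\<close>, clear
  coordinate \<open>n - 1\<close> if necessary, and flip coordinate \<open>n\<close>: the flipped coordinates are distinct,
  so this is a shortest path that meets \<open>\<Theta>\<^sub>1\<close>, \<open>\<Theta>\<^sub>i\<close> and \<open>\<Theta>\<^sub>n\<close>.
  Each of the two classes is in bijection with the Fibonacci strings of length \<open>n - 2\<close>.\<close>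

section \<open>Flipping coordinates\<close>

definition flip :: "bool list \<Rightarrow> nat \<Rightarrow> bool list" where
  "flip s j = s[j := \<not> s ! j]"

lemma length_flip [simp]: "length (flip s j) = length s"
  by (simp add: flip_def)

lemma nth_flip: "k < length s \<Longrightarrow> flip s j ! k \<longleftrightarrow> (s ! k \<noteq> (k = j))"
  by (auto simp: flip_def nth_list_update)

lemma flip_flip [simp]: "flip (flip s j) j = s"
  by (rule nth_equalityI) (auto simp: nth_flip)

lemma fib_strings_length: "s \<in> fib_strings n \<Longrightarrow> length s = n"
  by (simp add: fib_strings_def)

text \<open>Serves both for clearing a 1 and for setting a coordinate while the string stays below a
  fixed Fibonacci string \<open>b\<close>.\<close>

lemma fib_strings_downward:
  assumes "b \<in> fib_strings n" "length a = n" "\<And>j. j < n \<Longrightarrow> a ! j \<Longrightarrow> b ! j"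
  shows "a \<in> fib_strings n"
  using assms by (auto simp: fib_strings_def)

lemma flip_one_in_fib_strings:
  assumes "s \<in> fib_strings n" "s ! j"
  shows "flip s j \<in> fib_strings n"
  using assms by (auto intro!: fib_strings_downward[OF assms(1)] simp: fib_strings_length nth_flip)

text \<open>The two neighbour conditions are vacuous at the respective ends of the string, which is
  what allows flipping the first or the last coordinate.\<close>

lemma flip_isolated_in_fib_strings:
  assumes "s \<in> fib_strings n" "\<And>k. j = Suc k \<Longrightarrow> \<not> s ! k" "Suc j < n \<Longrightarrow> \<not> s ! Suc j"
  shows "flip s j \<in> fib_strings n"
  using assms by (auto simp: fib_strings_def nth_flip)

lemma fib_cube_edge_iff:
  \<comment> \<open>Replaces the unique differing coordinate by an explicit flip, so that paths can
    be described by sequences of flipped coordinates.\<close>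
  "{u, v} \<in> edges (fib_cube n) \<longleftrightarrow>
     u \<in> fib_strings n \<and> v \<in> fib_strings n \<and> (\<exists>j<n. v = flip u j)"
proof -
  have *: "(\<exists>!j. j < n \<and> u ! j \<noteq> v ! j) \<longleftrightarrow> (\<exists>j<n. v = flip u j)"
    if "length u = n" "length v = n" for u v
  proof
    assume "\<exists>!j. j < n \<and> u ! j \<noteq> v ! j"
    then obtain j where j: "j < n" "u ! j \<noteq> v ! j" "\<And>k. k < n \<Longrightarrow> u ! k \<noteq> v ! k \<Longrightarrow> k = j"
      by (elim ex1E) metis
    have "v ! k = flip u j ! k" if "k < n" for k
      using nth_flip[of k u j] j(2) j(3)[OF that] \<open>length u = n\<close> that by metis
    then have "v = flip u j"
      using that by (simp add: nth_equalityI)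
    then show "\<exists>j<n. v = flip u j" using j by blast
  next
    assume "\<exists>j<n. v = flip u j"
    then obtain j where j: "j < n" "v = flip u j" by blast
    then have "u ! k \<noteq> v ! k \<longleftrightarrow> k = j" if "k < n" for k
      using \<open>length u = n\<close> that by (auto simp: nth_flip)
    then show "\<exists>!j. j < n \<and> u ! j \<noteq> v ! j"
      using j(1) by (intro ex1I[of _ j]) auto
  qed
  have "{u, v} \<in> edges (fib_cube n) \<longleftrightarrow>
      u \<in> fib_strings n \<and> v \<in> fib_strings n \<and> (\<exists>!j. j < n \<and> u ! j \<noteq> v ! j)"
    (is "?E \<longleftrightarrow> ?R u v")
  proof
    assume ?E
    then obtain x y where xy: "{u, v} = {x, y}" "?R x y"
      unfolding fib_cube_def ugraph.select_convs mem_Collect_eq by metis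
    \<comment> \<open>An unordered edge may list its endpoints in either order.\<close>
    have sym: "(\<exists>!j. j < n \<and> x ! j \<noteq> y ! j) \<longleftrightarrow> (\<exists>!j. j < n \<and> y ! j \<noteq> x ! j)"
      by (intro arg_cong[where f = Ex1] ext) metis
    from xy(1) consider "x = u" "y = v" | "x = v" "y = u"
      by (metis doubleton_eq_iff)
    then show "?R u v" using xy(2) sym by cases simp_all
  next
    assume "?R u v"
    then show ?E
      unfolding fib_cube_def ugraph.select_convs mem_Collect_eq by metis
  qed
  then show ?thesis
    using *[of u v] fib_strings_length[of u n] fib_strings_length[of v n] by argo
qed

text \<open>Orients the edge: \<open>u\<close> is the endpoint with 0 in the flipped coordinate, an
  orientation that the maximality argument relies on.\<close>

lemma fib_cube_edge_cases:
  assumes "e \<in> edges (fib_cube n)"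
  obtains u j where "u \<in> fib_strings n" "j < n" "flip u j \<in> fib_strings n" "\<not> u ! j"
    "e = {u, flip u j}"
proof -
  obtain u v where uv: "e = {u, v}"
    using assms by (auto simp: fib_cube_def)
  then obtain j where j: "j < n" "v = flip u j" "u \<in> fib_strings n" "v \<in> fib_strings n"
    using assms by (auto simp: fib_cube_edge_iff)
  show ?thesis
  proof (cases "u ! j")
    case True
    then show ?thesis
      using that[of v j] j uv by (auto simp: nth_flip fib_strings_length)
  next
    case False
    then show ?thesis using that[of u j] j uv by auto
  qed
qed

lemma flip_edge_in_Theta_iff:
  assumes "u \<in> fib_strings n" "flip u j \<in> fib_strings n" "j < n" "c < n"
  shows "{u, flip u j} \<in> Theta (Suc c) (fib_cube n) \<longleftrightarrow> c = j"
proof -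
  have "{u, flip u j} \<in> edges (fib_cube n)"
    using assms by (auto simp: fib_cube_edge_iff)
  then have "{u, flip u j} \<in> Theta (Suc c) (fib_cube n) \<longleftrightarrow> u ! c \<noteq> flip u j ! c"
    by (auto simp: Theta_def doubleton_eq_iff)
  also have "\<dots> \<longleftrightarrow> c = j"
    using assms by (auto simp: nth_flip fib_strings_length)
  finally show ?thesis .
qed

lemma Theta_disjoint:
  assumes "c < n" "d < n" "c \<noteq> d"
  shows "Theta (Suc c) (fib_cube n) \<inter> Theta (Suc d) (fib_cube n) = {}"
proof (rule ccontr)
  assume "\<not> ?thesis"
  then obtain e where e: "e \<in> Theta (Suc c) (fib_cube n)" "e \<in> Theta (Suc d) (fib_cube n)"
    by blast
  then have "e \<in> edges (fib_cube n)" by (simp add: Theta_def)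
  then obtain u j where u: "u \<in> fib_strings n" "j < n" "flip u j \<in> fib_strings n"
      "e = {u, flip u j}"
    by (rule fib_cube_edge_cases)
  then have "c = j" "d = j"
    using e assms flip_edge_in_Theta_iff by auto
  with assms show False by simp
qed

section \<open>Shortest paths\<close>

text \<open>Encodes a walk by its start and its list of directions, so that lengths and
  \<open>Theta\<close>-classes can be read off \<open>js\<close>.\<close>

fun flip_walk :: "bool list \<Rightarrow> nat list \<Rightarrow> bool list list" where
  "flip_walk s [] = [s]"
| "flip_walk s (j # js) = s # flip_walk (flip s j) js"

lemma length_flip_walk [simp]: "length (flip_walk s js) = Suc (length js)"
  by (induction js arbitrary: s) auto

lemma flip_walk_not_Nil [simp]: "flip_walk s js \<noteq> []"
  by (cases js) auto

lemma hd_flip_walk [simp]: "hd (flip_walk s js) = s"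
  by (cases js) auto

lemma flip_walk_0 [simp]: "flip_walk s js ! 0 = s"
  by (cases js) auto

lemma flip_walk_Suc:
  "k < length js \<Longrightarrow> flip_walk s js ! Suc k = flip (flip_walk s js ! k) (js ! k)"
proof (induction js arbitrary: s k)
  case (Cons j js)
  then show ?case by (cases k) auto
qed simp

lemma flip_walk_length:
  "t \<in> set (flip_walk s js) \<Longrightarrow> length t = length s"
  by (induction js arbitrary: s) auto

lemma flip_walk_outside:
  "t \<in> set (flip_walk s js) \<Longrightarrow> c < length s \<Longrightarrow> c \<notin> set js \<Longrightarrow> t ! c = s ! c"
proof (induction js arbitrary: s)
  case (Cons j js)
  then have "t = s \<or> t ! c = flip s j ! c" by auto
  then show ?case using Cons.prems by (auto simp: nth_flip)
qed simp

lemma last_flip_walk_nth: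
  "distinct js \<Longrightarrow> c < length s \<Longrightarrow> last (flip_walk s js) ! c \<longleftrightarrow> (s ! c \<noteq> (c \<in> set js))"
  by (induction js arbitrary: s) (auto simp: nth_flip)

lemma distinct_flip_walk:
  "distinct js \<Longrightarrow> set js \<subseteq> {..<length s} \<Longrightarrow> distinct (flip_walk s js)"
proof (induction js arbitrary: s)
  case (Cons j js)
  \<comment> \<open>A return to \<open>s\<close> would require a second flip of \<open>j\<close>,
    but \<open>j\<close> does not occur in \<open>js\<close>.\<close>
  have "s \<notin> set (flip_walk (flip s j) js)"
  proof
    assume "s \<in> set (flip_walk (flip s j) js)"
    then have "s ! j = flip s j ! j"
      using Cons.prems by (intro flip_walk_outside) auto
    then show False using Cons.prems by (auto simp: nth_flip)
  qed
  with Cons show ?case by simp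
qed simp

lemma is_path_flip_walk:
  assumes "distinct js" "set js \<subseteq> {..<n}" "set (flip_walk s js) \<subseteq> fib_strings n"
  shows "is_path (fib_cube n) (flip_walk s js)"
proof -
  have "length s = n"
    using assms(3) by (cases js) (auto simp: fib_strings_length)
  moreover have "{flip_walk s js ! k, flip_walk s js ! Suc k} \<in> edges (fib_cube n)"
    if "k < length js" for k
  proof -
    have "flip_walk s js ! k \<in> fib_strings n" "flip_walk s js ! Suc k \<in> fib_strings n"
      using assms(3) that by (simp_all add: subset_iff)
    moreover have "js ! k < n" using assms(2) that by (auto simp: subset_iff)
    ultimately show ?thesis
      using that by (auto simp: fib_cube_edge_iff flip_walk_Suc)
  qed
  ultimately show ?thesis
    using assms distinct_flip_walk[of js s] by (auto simp: is_path_def fib_cube_def)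
qed

text \<open>Assumes only adjacency of consecutive vertices, a property that passes to the tail in
  the induction.\<close>

lemma chain_is_flip_walk:
  assumes "p \<noteq> []" "\<And>j. Suc j < length p \<Longrightarrow> {p ! j, p ! Suc j} \<in> edges (fib_cube n)"
  shows "\<exists>s js. p = flip_walk s js \<and> set js \<subseteq> {..<n}"
  using assms
proof (induction p)
  case (Cons s p)
  show ?case
  proof (cases "p = []")
    case True
    then have "s # p = flip_walk s [] \<and> set [] \<subseteq> {..<n}" by simp
    then show ?thesis by blast
  next
    case False
    have "\<And>j. Suc j < length p \<Longrightarrow> {p ! j, p ! Suc j} \<in> edges (fib_cube n)"
      using Cons.prems(2) by (metis Suc_less_eq length_Cons nth_Cons_Suc)
    then obtain t js where js: "p = flip_walk t js" "set js \<subseteq> {..<n}"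
      using Cons.IH False by blast
    have "{s, t} \<in> edges (fib_cube n)"
      using Cons.prems(2)[of 0] js by simp
    then obtain j where "j < n" "t = flip s j"
      by (auto simp: fib_cube_edge_iff)
    then have "s # p = flip_walk s (j # js) \<and> set (j # js) \<subseteq> {..<n}"
      using js by simp
    then show ?thesis by blast
  qed
qed simp

lemma is_path_flip_walkE:
  assumes "is_path (fib_cube n) p"
  obtains s js where "p = flip_walk s js" "set js \<subseteq> {..<n}"
  using chain_is_flip_walk[of p n] assms by (auto simp: is_path_def)

section \<open>Hamming distance and the characterization of shortest paths\<close>

definition differ :: "bool list \<Rightarrow> bool list \<Rightarrow> nat set" where
  "differ u v = {j. j < length u \<and> u ! j \<noteq> v ! j}"

lemma finite_differ [simp]: "finite (differ u v)"
  by (simp add: differ_def)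

text \<open>A coordinate that is never flipped keeps its value; this gives the Hamming lower bound
  on path lengths.\<close>

lemma differ_last_flip_walk_subset: "differ s (last (flip_walk s js)) \<subseteq> set js"
  using flip_walk_outside[of "last (flip_walk s js)" s js] by (auto simp: differ_def)

lemma differ_last_flip_walk:
  "distinct js \<Longrightarrow> set js \<subseteq> {..<length s} \<Longrightarrow> differ s (last (flip_walk s js)) = set js"
  by (auto simp: differ_def last_flip_walk_nth)

text \<open>Induction on the Hamming distance: surplus 1s of \<open>a\<close> are cleared first,
  then the missing 1s of \<open>b\<close> are set.\<close>

lemma fib_strings_monotone_walk:
  assumes "b \<in> fib_strings n"
  shows "a \<in> fib_strings n \<Longrightarrow>
    \<exists>js. distinct js \<and> set js = differ a b \<and> set (flip_walk a js) \<subseteq> fib_strings n"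
proof (induction "card (differ a b)" arbitrary: a)
  case 0
  then have "distinct [] \<and> set [] = differ a b \<and> set (flip_walk a []) \<subseteq> fib_strings n"
    by simp
  then show ?case by blast
next
  case (Suc k)
  have len: "length a = n" "length b = n"
    using Suc.prems assms by (simp_all add: fib_strings_length)
  have "\<exists>j \<in> differ a b. flip a j \<in> fib_strings n"
  proof (cases "\<exists>j \<in> differ a b. a ! j")
    case True
    then show ?thesis using Suc.prems flip_one_in_fib_strings by blast
  next
    case False
    from Suc.hyps(2) obtain j where j: "j \<in> differ a b"
      by (metis card.empty ex_in_conv nat.distinct(1))
    \<comment> \<open>All differing coordinates are now 0 in \<open>a\<close> and 1 in
      \<open>b\<close>, so \<open>a\<close> lies below \<open>b\<close>, and so does
      \<open>flip a j\<close>.\<close>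
    have "flip a j \<in> fib_strings n"
      by (rule fib_strings_downward[OF assms])
        (use False j len in \<open>auto simp: differ_def nth_flip\<close>)
    with j show ?thesis by blast
  qed
  then obtain j where j: "j \<in> differ a b" "flip a j \<in> fib_strings n"
    by blast
  then have d: "differ (flip a j) b = differ a b - {j}"
    by (auto simp: differ_def nth_flip)
  then have "k = card (differ (flip a j) b)"
    using j Suc.hyps(2) by simp
  from Suc.hyps(1)[OF this j(2)] obtain js where js: "distinct js"
      "set js = differ (flip a j) b" "set (flip_walk (flip a j) js) \<subseteq> fib_strings n"
    by blast
  have "distinct (j # js) \<and> set (j # js) = differ a b \<and>
      set (flip_walk a (j # js)) \<subseteq> fib_strings n"
    using js d j Suc.prems by auto
  then show ?case by blast
qed

lemma fib_cube_path_of_Hamming_length: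
  assumes "a \<in> fib_strings n" "b \<in> fib_strings n"
  obtains q where "is_path (fib_cube n) q" "hd q = a" "last q = b"
    "length q = Suc (card (differ a b))"
proof -
  obtain js where js: "distinct js" "set js = differ a b"
      "set (flip_walk a js) \<subseteq> fib_strings n"
    using fib_strings_monotone_walk assms by blast
  have len: "length a = n" "length b = n"
    using assms by (simp_all add: fib_strings_length)
  have "length (last (flip_walk a js)) = length a"
    by (rule flip_walk_length[of _ _ js]) simp
  then have "last (flip_walk a js) = b"
    by (intro nth_equalityI) (use js len in \<open>auto simp: last_flip_walk_nth differ_def\<close>)
  moreover have "is_path (fib_cube n) (flip_walk a js)"
    using js len by (intro is_path_flip_walk) (auto simp: differ_def)
  moreover have "length (flip_walk a js) = Suc (card (differ a b))"
    using js distinct_card by force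
  ultimately show ?thesis using that by simp
qed

text \<open>With distinct directions the endpoints differ exactly in \<open>set js\<close>, and any
  competing path must flip all of these coordinates.\<close>

lemma is_shortest_path_flip_walk:
  assumes "distinct js" "set js \<subseteq> {..<n}" "set (flip_walk s js) \<subseteq> fib_strings n"
  shows "is_shortest_path (fib_cube n) (flip_walk s js)"
  unfolding is_shortest_path_def
proof (intro conjI allI impI)
  show "is_path (fib_cube n) (flip_walk s js)"
    using assms by (rule is_path_flip_walk)
  fix q
  assume q: "is_path (fib_cube n) q \<and> hd q = hd (flip_walk s js) \<and>
    last q = last (flip_walk s js)"
  then obtain ks where ks: "q = flip_walk s ks"
    using is_path_flip_walkE by (metis hd_flip_walk)
  have "length s = n"
    using assms(3) by (cases js) (auto simp: fib_strings_length)
  then have "set js = differ s (last q)"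
    using assms q differ_last_flip_walk by simp
  also have "\<dots> \<subseteq> set ks"
    unfolding ks by (rule differ_last_flip_walk_subset)
  finally have "card (set js) \<le> card (set ks)"
    by (simp add: card_mono)
  also have "\<dots> \<le> length ks" by (rule card_length)
  finally show "length (flip_walk s js) \<le> length q"
    using assms(1) ks by (simp add: distinct_card)
qed

text \<open>A repeated direction would make the path longer than one of Hamming length between the
  same endpoints.\<close>

lemma is_shortest_path_flip_walkE:
  assumes "is_shortest_path (fib_cube n) p"
  obtains s js where "p = flip_walk s js" "set js \<subseteq> {..<n}" "distinct js"
proof -
  have path: "is_path (fib_cube n) p"
    using assms by (simp add: is_shortest_path_def)
  then obtain s js where js: "p = flip_walk s js" "set js \<subseteq> {..<n}"
    by (rule is_path_flip_walkE)
  have "p \<noteq> []" "set p \<subseteq> fib_strings n"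
    using path by (auto simp: is_path_def fib_cube_def)
  then have "hd p \<in> fib_strings n" "last p \<in> fib_strings n"
    by auto
  then obtain q where "is_path (fib_cube n) q" "hd q = hd p" "last q = last p"
      "length q = Suc (card (differ (hd p) (last p)))"
    by (rule fib_cube_path_of_Hamming_length)
  then have "length p \<le> Suc (card (differ (hd p) (last p)))"
    using assms by (metis is_shortest_path_def)
  moreover have "length p = Suc (length js)"
    using js(1) by simp
  moreover have "differ (hd p) (last p) \<subseteq> set js"
    using js(1) differ_last_flip_walk_subset[of s js] by simp
  then have "card (differ (hd p) (last p)) \<le> card (set js)"
    by (simp add: card_mono)
  \<comment> \<open>The chain \<open>length js\<close> \<le> Hamming distance \<le>
    \<open>card (set js)\<close> \<le> \<open>length js\<close> collapses.\<close>
  ultimately have "card (set js) = length js"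
    using card_length[of js] by linarith
  then show ?thesis using that js card_distinct by blast
qed

section \<open>Edges of the \<open>Theta\<close>-classes along walks\<close>

lemma path_edges_flip_walk:
  "path_edges (flip_walk s js) =
     {{flip_walk s js ! k, flip (flip_walk s js ! k) (js ! k)} | k. k < length js}"
  unfolding path_edges_def by (intro Collect_cong ex_cong1) (auto simp: flip_walk_Suc)

lemma flip_walk_Theta_edge:
  assumes "set js \<subseteq> {..<n}" "set (flip_walk s js) \<subseteq> fib_strings n" "c \<in> set js"
  obtains e where "e \<in> path_edges (flip_walk s js)" "e \<in> Theta (Suc c) (fib_cube n)"
proof -
  obtain k where k: "k < length js" "c = js ! k"
    using assms(3) by (auto simp: in_set_conv_nth)
  have "flip_walk s js ! k \<in> fib_strings n" "flip_walk s js ! Suc k \<in> fib_strings n"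
    using assms(2) k by (simp_all add: subset_iff)
  then have "{flip_walk s js ! k, flip (flip_walk s js ! k) c} \<in> Theta (Suc c) (fib_cube n)"
    using assms k by (subst flip_edge_in_Theta_iff) (auto simp: flip_walk_Suc subset_iff)
  moreover have "{flip_walk s js ! k, flip (flip_walk s js ! k) c} \<in> path_edges (flip_walk s js)"
    using k by (auto simp: path_edges_flip_walk)
  ultimately show ?thesis using that by blast
qed

text \<open>An edge of the class sits at a position where \<open>js\<close> has the entry
  \<open>c\<close>; since \<open>js\<close> is distinct, there is only one such position.\<close>

lemma shortest_path_Theta_unique:
  assumes "is_shortest_path (fib_cube n) p" "c < n"
    "e \<in> path_edges p" "e \<in> Theta (Suc c) (fib_cube n)"
    "f \<in> path_edges p" "f \<in> Theta (Suc c) (fib_cube n)"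
  shows "e = f"
proof -
  obtain s js where js: "p = flip_walk s js" "set js \<subseteq> {..<n}" "distinct js"
    using assms(1) by (rule is_shortest_path_flip_walkE)
  have index: "\<exists>k < length js. js ! k = c \<and> e = {p ! k, flip (p ! k) (js ! k)}"
    if e: "e \<in> path_edges p" "e \<in> Theta (Suc c) (fib_cube n)" for e
  proof -
    obtain k where k: "k < length js" "e = {p ! k, flip (p ! k) (js ! k)}"
      using e(1) js(1) path_edges_flip_walk[of s js] by auto
    have "e \<in> edges (fib_cube n)" using e(2) by (simp add: Theta_def)
    then have "p ! k \<in> fib_strings n" "flip (p ! k) (js ! k) \<in> fib_strings n"
      by (simp_all add: k fib_cube_edge_iff)
    moreover have "js ! k < n" using js(2) k by (auto simp: subset_iff)
    ultimately have "js ! k = c"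
      using e(2) assms(2) k flip_edge_in_Theta_iff by metis
    then show ?thesis using k by blast
  qed
  obtain k l where "k < length js" "js ! k = c" "e = {p ! k, flip (p ! k) (js ! k)}"
      "l < length js" "js ! l = c" "f = {p ! l, flip (p ! l) (js ! l)}"
    using index assms by metis
  moreover from this have "k = l"
    using js(3) nth_eq_iff_index_eq by metis
  ultimately show ?thesis by simp
qed

section \<open>The two outer classes\<close>

text \<open>Pigeonhole: of three edges from two classes, two share a class and hence coincide on a
  shortest path.\<close>

lemma edge_gp_set_Theta_Un_Theta:
  assumes "c < n" "d < n"
  shows "edge_gp_set (fib_cube n) (Theta (Suc c) (fib_cube n) \<union> Theta (Suc d) (fib_cube n))"
proof -
  have "Theta (Suc c) (fib_cube n) \<union> Theta (Suc d) (fib_cube n) \<subseteq> edges (fib_cube n)"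
    by (auto simp: Theta_def)
  moreover have "e = f \<or> e = g \<or> f = g"
    if p: "is_shortest_path (fib_cube n) p" "{e, f, g} \<subseteq> path_edges p"
      and "e \<in> Theta (Suc c) (fib_cube n) \<union> Theta (Suc d) (fib_cube n)"
      "f \<in> Theta (Suc c) (fib_cube n) \<union> Theta (Suc d) (fib_cube n)"
      "g \<in> Theta (Suc c) (fib_cube n) \<union> Theta (Suc d) (fib_cube n)" for p e f g
    using that(3-5) p(2) shortest_path_Theta_unique[OF p(1) assms(1)]
      shortest_path_Theta_unique[OF p(1) assms(2)]
    by (metis Un_iff insert_subset)
  ultimately show ?thesis
    unfolding edge_gp_set_def by metis
qed

text \<open>Starting at \<open>flip u i\<close> puts the given edge first. As \<open>u ! i\<close>
  is then 0, coordinate \<open>i\<close> is not cleared again, even if it is next to an end.\<close>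

lemma inner_edge_on_outer_path:
  assumes u: "u \<in> fib_strings n" "flip u i \<in> fib_strings n" "\<not> u ! i"
    and i: "0 < i" "Suc i < n"
  obtains js where "distinct js" "set js \<subseteq> {..<n}"
    "set (flip_walk (flip u i) js) \<subseteq> fib_strings n"
    "0 \<in> set js" "n - 1 \<in> set js" "{u, flip u i} \<in> path_edges (flip_walk (flip u i) js)"
proof -
  \<comment> \<open>Counted from 0, \<open>Suc m\<close> is the last but one coordinate and
    \<open>Suc (Suc m)\<close> the last.\<close>
  obtain m where n: "n = Suc (Suc (Suc m))"
    using i by (metis Suc_lessE less_imp_Suc_add add_Suc_right)
  have len: "length u = n" using u by (simp add: fib_strings_length)
  define js1 where "js1 = (if u ! 1 then [1 :: nat] else [])"
  define js2 where "js2 = (if u ! Suc m then [Suc m] else [])"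
  define js where "js = i # js1 @ [0] @ js2 @ [Suc (Suc m)]"
  define u1 where "u1 = (if u ! 1 then flip u 1 else u)"
  define u2 where "u2 = flip u1 0"
  define u3 where "u3 = (if u ! Suc m then flip u2 (Suc m) else u2)"
  define u4 where "u4 = flip u3 (Suc (Suc m))"
  \<comment> \<open>If \<open>m = 0\<close>, then \<open>1\<close>, \<open>Suc m\<close> and
    \<open>i\<close> are the same coordinate, where \<open>u\<close> is 0. So whenever something is
    cleared, \<open>1\<close> and \<open>Suc m\<close> are different coordinates.\<close>
  have m0: "m \<noteq> 0" if "u ! 1 \<or> u ! Suc m"
  proof
    assume "m = 0"
    then have "i = 1" using i n by simp
    with that \<open>m = 0\<close> u(3) show False by simp
  qed
  have u1: "u1 \<in> fib_strings n" "\<not> u1 ! 1"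
    using u(1) len n by (auto simp: u1_def flip_one_in_fib_strings nth_flip)
  then have u2: "u2 \<in> fib_strings n"
    unfolding u2_def by (intro flip_isolated_in_fib_strings) auto
  have u2m: "u2 ! Suc m \<longleftrightarrow> u ! Suc m"
    using len n m0 by (auto simp: u2_def u1_def nth_flip)
  have u3: "u3 \<in> fib_strings n" "\<not> u3 ! Suc m"
    using u2 u2m n flip_one_in_fib_strings[OF u2]
    by (auto simp: u3_def nth_flip fib_strings_length)
  then have u4: "u4 \<in> fib_strings n"
    unfolding u4_def using n by (intro flip_isolated_in_fib_strings) auto
  have "distinct js"
    using i n u(3) m0 by (auto simp: js_def js1_def js2_def)
  moreover have "set js \<subseteq> {..<n}"
    using i n by (auto simp: js_def js1_def js2_def)
  moreover have "set (flip_walk (flip u i) js) \<subseteq> {flip u i, u, u1, u2, u3, u4}"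
    by (auto simp: js_def js1_def js2_def u1_def u2_def u3_def u4_def)
  then have "set (flip_walk (flip u i) js) \<subseteq> fib_strings n"
    using u u1 u2 u3 u4 by blast
  moreover have "0 \<in> set js" "n - 1 \<in> set js"
    using n by (auto simp: js_def)
  moreover have "{u, flip u i} \<in> path_edges (flip_walk (flip u i) js)"
    \<comment> \<open>The edge is traversed at position 0, from \<open>flip u i\<close> to
      \<open>u\<close>.\<close>
    unfolding path_edges_flip_walk by (auto intro!: exI[of _ 0] simp: js_def)
  ultimately show ?thesis using that by blast
qed

lemma maximal_edge_gp_set_outer_Thetas:
  assumes "n \<ge> 2"
  shows "maximal_edge_gp_set (fib_cube n) (Theta 1 (fib_cube n) \<union> Theta n (fib_cube n))"
    (is "maximal_edge_gp_set ?G (?A \<union> ?B)")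
proof -
  have A: "?A = Theta (Suc 0) ?G" and B: "?B = Theta (Suc (n - 1)) ?G"
    using assms by simp_all
  have "edge_gp_set ?G (?A \<union> ?B)"
    unfolding A B using assms by (intro edge_gp_set_Theta_Un_Theta) auto
  moreover have "Y \<subseteq> ?A \<union> ?B" if Y: "edge_gp_set ?G Y" "?A \<union> ?B \<subseteq> Y" for Y
  proof (rule ccontr)
    assume "\<not> ?thesis"
    then obtain e where e: "e \<in> Y" "e \<notin> ?A" "e \<notin> ?B" by blast
    then have "e \<in> edges ?G" using Y(1) by (auto simp: edge_gp_set_def)
    then obtain u i where u: "u \<in> fib_strings n" "i < n" "flip u i \<in> fib_strings n" "\<not> u ! i"
        "e = {u, flip u i}"
      by (rule fib_cube_edge_cases)
    have "i \<noteq> 0" "i \<noteq> n - 1"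
      using e u assms flip_edge_in_Theta_iff[of u n i 0] flip_edge_in_Theta_iff[of u n i "n - 1"]
      unfolding A B by auto
    \<comment> \<open>For \<open>n = 2\<close> these bounds already clash, so that case is covered
      as well.\<close>
    then have i: "0 < i" "Suc i < n" using u(2) by auto
    obtain js where js: "distinct js" "set js \<subseteq> {..<n}"
        "set (flip_walk (flip u i) js) \<subseteq> fib_strings n" "0 \<in> set js" "n - 1 \<in> set js"
        "e \<in> path_edges (flip_walk (flip u i) js)"
      using inner_edge_on_outer_path[OF u(1,3,4) i] u(5) by blast
    obtain f where f: "f \<in> path_edges (flip_walk (flip u i) js)" "f \<in> ?A"
      unfolding A using flip_walk_Theta_edge[OF js(2,3,4)] .
    obtain g where g: "g \<in> path_edges (flip_walk (flip u i) js)" "g \<in> ?B"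
      unfolding B using flip_walk_Theta_edge[OF js(2,3,5)] .
    \<comment> \<open>Here \<open>n \<ge> 2\<close> enters: it makes the first and the last
      coordinate different.\<close>
    have "f \<noteq> g"
      using f g Theta_disjoint[of 0 n "n - 1"] assms unfolding A B by auto
    moreover have "e \<noteq> f" "e \<noteq> g" using e f g by auto
    moreover have "is_shortest_path ?G (flip_walk (flip u i) js)"
      using js by (intro is_shortest_path_flip_walk)
    moreover have "f \<in> Y" "g \<in> Y" using f g Y(2) by auto
    ultimately show False
      using Y(1) e(1) f(1) g(1) js(6) unfolding edge_gp_set_def by blast
  qed
  ultimately show ?thesis
    unfolding maximal_edge_gp_set_def by blast
qed

section \<open>Counting the edges of the two outer classes\<close>

lemma Cons_False_in_fib_strings: "s \<in> fib_strings n \<Longrightarrow> False # s \<in> fib_strings (Suc n)"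
  by (auto simp: fib_strings_def nth_Cons split: nat.split)

lemma Cons_True_False_in_fib_strings:
  "s \<in> fib_strings n \<Longrightarrow> True # False # s \<in> fib_strings (Suc (Suc n))"
  by (auto simp: fib_strings_def nth_Cons split: nat.split)

lemma snoc_False_in_fib_strings: "s \<in> fib_strings n \<Longrightarrow> s @ [False] \<in> fib_strings (Suc n)"
  by (auto simp: fib_strings_def nth_append)

lemma snoc_False_True_in_fib_strings:
  "s \<in> fib_strings n \<Longrightarrow> s @ [False, True] \<in> fib_strings (Suc (Suc n))"
  by (auto simp: fib_strings_def nth_append nth_Cons split: nat.splits)

lemma finite_fib_strings: "finite (fib_strings n)"
  by (rule finite_subset[OF _ finite_lists_length_eq[of UNIV n]]) (auto simp: fib_strings_def)

text \<open>Prefixing \<open>False\<close> or \<open>True, False\<close> gives disjoint injective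
  images of the two shorter sets of strings, matching the Fibonacci recurrence.\<close>

lemma fib_le_card_fib_strings: "fib (n + 2) \<le> card (fib_strings n)"
proof (induction n rule: fib.induct)
  case 1
  have "fib_strings 0 = {[]}" by (auto simp: fib_strings_def)
  then show ?case by simp
next
  case 2
  have "{[False], [True]} \<subseteq> fib_strings 1" by (auto simp: fib_strings_def)
  from card_mono[OF finite_fib_strings this] show ?case by (simp add: numeral_eq_Suc)
next
  case (3 n)
  let ?S = "Cons False ` fib_strings (Suc n)" and ?T = "(\<lambda>s. True # False # s) ` fib_strings n"
  have "fib (Suc (Suc n) + 2) \<le> card (fib_strings (Suc n)) + card (fib_strings n)"
    using 3 by simp
  also have "\<dots> = card ?S + card ?T"
    by (simp add: card_image inj_on_def)
  also have "\<dots> = card (?S \<union> ?T)"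
    by (rule card_Un_disjoint[symmetric]) (auto simp: finite_fib_strings)
  also have "\<dots> \<le> card (fib_strings (Suc (Suc n)))"
    by (rule card_mono)
      (auto simp: finite_fib_strings intro: Cons_False_in_fib_strings Cons_True_False_in_fib_strings)
  finally show ?case .
qed

lemma finite_Theta: "finite (Theta i (fib_cube n))"
  by (rule finite_subset[OF _ finite_edges_fib_cube]) (auto simp: Theta_def)

text \<open>Flipping the first coordinate is possible when the second is 0, and the remaining
  \<open>m\<close> coordinates may then form any Fibonacci string.\<close>

lemma card_Theta_first: "card (fib_strings m) \<le> card (Theta 1 (fib_cube (m + 2)))"
proof (rule card_inj_on_le[OF _ _ finite_Theta])
  let ?e = "\<lambda>s. {False # False # s, True # False # s}"
  show "inj_on ?e (fib_strings m)"
    by (auto simp: inj_on_def doubleton_eq_iff)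
  have "?e s \<in> Theta (Suc 0) (fib_cube (m + 2))" if s: "s \<in> fib_strings m" for s
  proof -
    have "flip (False # False # s) 0 = True # False # s" by (simp add: flip_def)
    then show ?thesis
      using flip_edge_in_Theta_iff[of "False # False # s" "m + 2" 0 0] s
      by (simp add: Cons_False_in_fib_strings Cons_True_False_in_fib_strings)
  qed
  then show "?e ` fib_strings m \<subseteq> Theta 1 (fib_cube (m + 2))" by auto
qed

text \<open>The mirror image, with the free string in front and the last coordinate flipped behind a
  0.\<close>

lemma card_Theta_last: "card (fib_strings m) \<le> card (Theta (m + 2) (fib_cube (m + 2)))"
proof (rule card_inj_on_le[OF _ _ finite_Theta])
  let ?e = "\<lambda>s. {s @ [False, False], s @ [False, True]}"
  show "inj_on ?e (fib_strings m)"
    by (auto simp: inj_on_def doubleton_eq_iff)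
  have "?e s \<in> Theta (Suc (Suc m)) (fib_cube (m + 2))" if s: "s \<in> fib_strings m" for s
  proof -
    have "flip (s @ [False, False]) (Suc m) = s @ [False, True]"
      using s by (auto simp: flip_def nth_append list_update_append fib_strings_length)
    moreover have "s @ [False, False] \<in> fib_strings (m + 2)"
      using snoc_False_in_fib_strings[OF snoc_False_in_fib_strings[OF s]] by simp
    ultimately show ?thesis
      using flip_edge_in_Theta_iff[of "s @ [False, False]" "m + 2" "Suc m" "Suc m"] s
      by (simp add: snoc_False_True_in_fib_strings)
  qed
  then show "?e ` fib_strings m \<subseteq> Theta (m + 2) (fib_cube (m + 2))" by auto
qed

lemma card_le_gp_e:
  assumes "finite (edges G)" "edge_gp_set G X"
  shows "card X \<le> gp_e G"
  unfolding gp_e_def using assms by (intro Max_ge) (auto simp: finite_edge_gp_sets)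

theorem theorem4p3:
  fixes n :: nat
  assumes "n \<ge> 2"
  shows "maximal_edge_gp_set (fib_cube n) (Theta 1 (fib_cube n) \<union> Theta n (fib_cube n)) \<and>
         gp_e (fib_cube n) \<ge> 2 * fib n"
proof
  let ?G = "fib_cube n"
  show max: "maximal_edge_gp_set ?G (Theta 1 ?G \<union> Theta n ?G)"
    using assms by (rule maximal_edge_gp_set_outer_Thetas)
  \<comment> \<open>With \<open>m\<close> free coordinates per edge, the shift in
    \<open>fib (m + 2)\<close> gives exactly \<open>fib n\<close> for each class.\<close>
  obtain m where n: "n = m + 2"
    using assms by (metis add.commute le_iff_add)
  have "2 * fib n \<le> card (Theta 1 ?G) + card (Theta n ?G)"
    using fib_le_card_fib_strings[of m] card_Theta_first[of m] card_Theta_last[of m]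
    unfolding n by linarith
  also have "\<dots> = card (Theta 1 ?G \<union> Theta n ?G)"
    using Theta_disjoint[of 0 n "n - 1"] assms
    by (intro card_Un_disjoint[symmetric]) (auto simp: finite_Theta)
  also have "\<dots> \<le> gp_e ?G"
    using max finite_edges_fib_cube
    by (intro card_le_gp_e) (auto simp: maximal_edge_gp_set_def)
  finally show "2 * fib n \<le> gp_e ?G" .
qed

end
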